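(* Let $G,H$ be countable discrete groups, let $F\subseteq G\wr H$ be finite and let $\varepsilon>0$. Then there are finite sets $E_A\subseteq G$, $E_B\subseteq H$ and an $\varepsilon'>0$ such that, whenever $A,B$ are finite sets and $\sigma_A\colon G\to\mathrm{Sym}(A)$ and $\sigma_B\colon H\to\mathrm{Sym}(B)$ are an $(E_A,\varepsilon')$-sofic approximation of $G$ and an $(E_B,\varepsilon')$-sofic approximation of $H$ respectively, the map $$\widehat{\sigma}\colon G\wr H\to\mathrm{Sym}\left(\left(\bigoplus_B A\right)\oplus B\right)$$ constructed from $F,\sigma_A,\sigma_B$ as described in the context is an $(F,\varepsilon)$-sofic approximation.
   Context: **Sofic approximations.** For a finite (nonempty) set $A$, $d_{\mathrm{Hamm}}(\sigma,\tau)=\frac{1}{|A|}|\{a\in A:\sigma(a)\neq\tau(a)\}|$ on $\mathrm{Sym}(A)$. For a countable discrete group $\Gamma$, finite $F\subseteq\Gamma$ and $\varepsilon>0$, a function $\sigma\colon\Gamma\to\mathrm{Sym}(A)$ (not assumed to be a homomorphism) is $(F,\varepsilon)$-multiplicative if $\max_{g,h\in F}d_{\mathrm{Hamm}}(\sigma(g)\sigma(h),\sigma(gh))<\varepsilon$; it is $(F,\varepsilon)$-free if $\min_{g\in F\setminus\{1\}}d_{\mathrm{Hamm}}(\sigma(g),\mathrm{Id})>1-\varepsilon$; it is an $(F,\varepsilon)$-sofic approximation if it is $(F,\varepsilon)$-multiplicative, $(F,\varepsilon)$-free and $\sigma(1)=\mathrm{Id}$. **Wreath product.** $G\wr H=\left(\bigoplus_H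 G\right)\rtimes H$, where $\bigoplus_H G$ is the group of finitely supported families $(g_x)_{x\in H}$ in $G$, and $h\in H$ acts by $\alpha_h((g_x)_{x\in H})=(g_{h^{-1}x})_{x\in H}$. Put $\pi_G(g,h)=g\in\bigoplus_H G$, $\pi_H(g,h)=h\in H$, and $\mathrm{Supp}(g)=\{x\in H:g_x\neq 1\}$. For $E\subseteq H$, $\bigoplus_E G$ is identified with the subgroup of $g\in\bigoplus_H G$ with $\mathrm{Supp}(g)\subseteq E$. **The set $E$.** Given $F$, let $F_0=F\cup\{1\}\cup F^{-1}$, $E_1=\{\alpha_h(g):h\in\pi_H(F_0),\,g\in\pi_G(F_0)\}$, $E_2=\pi_H(F_0)$, and $$E=E_2\cup\bigcup_{g\in E_1,\,h\in E_2}h\,\mathrm{Supp}(g),$$ a finite subset of $H$. **The set $B_0$.** Given $\sigma_B\colon H\to\mathrm{Sym}(B)$, let $B_0=B_{01}\cap B_{02}$, where $$B_{01}=\{b\in B:\sigma_B(h_1)b\neq\sigma_B(h_2)b\text{ for all }h_1,h_2\in E,\ h_1\neq h_2\},$$ $$B_{02}=\{b\in B:\sigma_B(h_1h_2)b=\sigma_B(h_1)\sigma_B(h_2)b\text{ for all }h_1,h_2\in E\}.$$ **The map $\widehat\sigma$.** Here $\bigoplus_B A$ denotes the set of all families $(a_b)_{b\in B}$ with $a_b\in A$ (that is, $A^B$), and $\left(\bigoplus_B A\right)\oplus B$ denotes the set of pairs $(a,b)$ with $a\in\bigoplus_B A$ and $b\in B$. For $h\in H$, $b_0\in B$, $g\in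 G$, let $\sigma_{A,b_0}^{(h)}(g)\in\mathrm{Sym}\left(\bigoplus_B A\right)$ be given by $\sigma_{A,b_0}^{(h)}(g)\big((a_b)_{b\in B}\big)=(\widehat a_b)_{b\in B}$, with $\widehat a_b=\sigma_A(g)(a_b)$ if $b=\sigma_B(h)b_0$, and $\widehat a_b=a_b$ otherwise. For $b\in B_0$ and $g=(g_x)_{x\in E}\in\bigoplus_E G$, put $\sigma_{A,b}(g)=\prod_{x\in E}\sigma_{A,b}^{(x)}(g_x)$; the factors commute because $b\in B_{01}$. For $g\in\bigoplus_E G$ let $$\widehat{\sigma_A}(g)(a,b)=\begin{cases}(\sigma_{A,b}(g)(a),b),&b\in B_0,\\(a,b),&b\in B\setminus B_0,\end{cases}$$ and for $g\in\bigoplus_H G$ with $g\notin\bigoplus_E G$ let $\widehat{\sigma_A}(g)=\mathrm{Id}$. For $h\in H$ let $\widehat{\sigma_B}(h)(a,b)=(a,\sigma_B(h)b)$. Finally $\widehat\sigma(g,h)=\widehat{\sigma_A}(g)\,\widehat{\sigma_B}(h)$ for $(g,h)\in G\wr H$.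
   Formalization: Products of permutations are read left to right throughout (first σ, then τ); with the usual order the claim fails, e.g. G=A=Z/2, H=B=Z/3 with regular actions. A, B range over subsets of fixed types chosen before E_A, E_B, ε'; taking both to be the naturals and relabelling covers all finite sets. *)

theory Defs
  imports "HOL-Algebra.Product_Groups" "HOL-Combinatorics.Permutations"
    "HOL-Library.Countable_Set" Complex_Main
begin

section \<open>Symmetric groups and sofic approximations\<close>

text \<open>
  Products in the symmetric group are read from left to right: \<open>\<sigma> \<otimes> \<tau>\<close> is ``first \<open>\<sigma>\<close>, then \<open>\<tau>\<close>''.
  Every product of permutations below (in almost multiplicativity, in \<open>B\<^sub>0\<^sub>2\<close>, in the product over
  \<open>E\<close> and in \<open>\<sigma>\<^sub>A \<sigma>\<^sub>B\<close>) is taken in this group.  The choice matters: the action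
  \<open>(\<alpha>\<^sub>h g)\<^sub>x = g\<^bsub>h\<^sup>-\<^sup>1 x\<^esub>\<close>, together with the rule that \<open>g\<^sub>x\<close> acts on the coordinate
  \<open>\<sigma>\<^sub>B(x) b\<close>, forces it.  Indeed \<open>(1,h)(g,1) = (\<alpha>\<^sub>h g, h)\<close>, and \<open>\<alpha>\<^sub>h g\<close> acts by \<open>g\<^sub>x\<close> on the
  coordinate \<open>\<sigma>\<^sub>B(hx) b\<close> while \<open>\<sigma>(1,h)\<close> followed by \<open>\<sigma>(g,1)\<close> acts by \<open>g\<^sub>x\<close> on the coordinate
  \<open>\<sigma>\<^sub>B(x) (\<sigma>\<^sub>B(h) b)\<close>; these agree when the product \<open>\<sigma>\<^sub>B(h) \<sigma>\<^sub>B(x)\<close> applies \<open>\<sigma>\<^sub>B(h)\<close> first.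
  For sofic approximations as such the convention is immaterial: \<open>g \<mapsto> \<sigma>(g)\<^sup>-\<^sup>1\<close> exchanges the
  two conventions and is isometric for the Hamming distance.
\<close>

definition Sym_group :: "'a set \<Rightarrow> ('a \<Rightarrow> 'a) monoid" where
  "Sym_group A = \<lparr>carrier = {p. p permutes A}, monoid.mult = (\<lambda>\<sigma> \<tau>. \<tau> \<circ> \<sigma>), one = id\<rparr>"

definition hamming_dist :: "'a set \<Rightarrow> ('a \<Rightarrow> 'a) \<Rightarrow> ('a \<Rightarrow> 'a) \<Rightarrow> real" where
  "hamming_dist A \<sigma> \<tau> = real (card {a \<in> A. \<sigma> a \<noteq> \<tau> a}) / real (card A)"

definition sofic_multiplicative ::
  "('g, 'm) monoid_scheme \<Rightarrow> 'g set \<Rightarrow> real \<Rightarrow> 'a set \<Rightarrow> ('g \<Rightarrow> 'a \<Rightarrow> 'a) \<Rightarrow> bool" where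
  "sofic_multiplicative \<Gamma> F \<epsilon> A \<sigma> \<longleftrightarrow>
     (\<forall>g\<in>F. \<forall>h\<in>F. hamming_dist A (\<sigma> g \<otimes>\<^bsub>Sym_group A\<^esub> \<sigma> h) (\<sigma> (g \<otimes>\<^bsub>\<Gamma>\<^esub> h)) < \<epsilon>)"

definition sofic_free ::
  "('g, 'm) monoid_scheme \<Rightarrow> 'g set \<Rightarrow> real \<Rightarrow> 'a set \<Rightarrow> ('g \<Rightarrow> 'a \<Rightarrow> 'a) \<Rightarrow> bool" where
  "sofic_free \<Gamma> F \<epsilon> A \<sigma> \<longleftrightarrow>
     (\<forall>g\<in>F - {\<one>\<^bsub>\<Gamma>\<^esub>}. hamming_dist A (\<sigma> g) \<one>\<^bsub>Sym_group A\<^esub> > 1 - \<epsilon>)"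

definition sofic_approximation ::
  "('g, 'm) monoid_scheme \<Rightarrow> 'g set \<Rightarrow> real \<Rightarrow> 'a set \<Rightarrow> ('g \<Rightarrow> 'a \<Rightarrow> 'a) \<Rightarrow> bool" where
  "sofic_approximation \<Gamma> F \<epsilon> A \<sigma> \<longleftrightarrow>
     \<sigma> \<in> carrier \<Gamma> \<rightarrow> carrier (Sym_group A) \<and>
     sofic_multiplicative \<Gamma> F \<epsilon> A \<sigma> \<and>
     sofic_free \<Gamma> F \<epsilon> A \<sigma> \<and>
     \<sigma> \<one>\<^bsub>\<Gamma>\<^esub> = \<one>\<^bsub>Sym_group A\<^esub>"


section \<open>The wreath product\<close>

abbreviation base_group :: "('g, 'm) monoid_scheme \<Rightarrow> ('h, 'n) monoid_scheme \<Rightarrow> ('h \<Rightarrow> 'g) monoid" where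
  "base_group G H \<equiv> sum_group (carrier H) (\<lambda>_. G)"

definition shift :: "('h, 'n) monoid_scheme \<Rightarrow> 'h \<Rightarrow> ('h \<Rightarrow> 'g) \<Rightarrow> 'h \<Rightarrow> 'g" where
  "shift H h g = (\<lambda>x\<in>carrier H. g (inv\<^bsub>H\<^esub> h \<otimes>\<^bsub>H\<^esub> x))"

definition wreath ::
  "('g, 'm) monoid_scheme \<Rightarrow> ('h, 'n) monoid_scheme \<Rightarrow> (('h \<Rightarrow> 'g) \<times> 'h) monoid" where
  "wreath G H =
     \<lparr>carrier = carrier (base_group G H) \<times> carrier H,
      monoid.mult = (\<lambda>(g, h) (g', h'). (g \<otimes>\<^bsub>base_group G H\<^esub> shift H h g', h \<otimes>\<^bsub>H\<^esub> h')),
      one = (\<one>\<^bsub>base_group G H\<^esub>, \<one>\<^bsub>H\<^esub>)\<rparr>"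

definition Supp :: "('g, 'm) monoid_scheme \<Rightarrow> ('h, 'n) monoid_scheme \<Rightarrow> ('h \<Rightarrow> 'g) \<Rightarrow> 'h set" where
  "Supp G H g = {x \<in> carrier H. g x \<noteq> \<one>\<^bsub>G\<^esub>}"

lemma group_Sym_group: "group (Sym_group A)"
proof (rule groupI)
  fix p assume "p \<in> carrier (Sym_group A)"
  then show "\<exists>q\<in>carrier (Sym_group A). q \<otimes>\<^bsub>Sym_group A\<^esub> p = \<one>\<^bsub>Sym_group A\<^esub>"
    by (intro bexI[of _ "inv_into UNIV p"])
      (auto simp: Sym_group_def permutes_inv permutes_inv_o)
qed (auto simp: Sym_group_def permutes_compose permutes_id o_assoc)

lemma shift_base_group:
  assumes "group G" "group H" "h \<in> carrier H" "g \<in> carrier (base_group G H)"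
  shows "shift H h g \<in> carrier (base_group G H)"
proof -
  interpret G: group G by fact
  interpret H: group H by fact
  have g: "g \<in> (\<Pi>\<^sub>E i\<in>carrier H. carrier G)" and fin: "finite (Supp G H g)"
    using assms by (simp_all add: carrier_sum_group Supp_def)
  have "{x \<in> carrier H. shift H h g x \<noteq> \<one>\<^bsub>G\<^esub>} \<subseteq> (\<lambda>x. h \<otimes>\<^bsub>H\<^esub> x) ` Supp G H g"
  proof
    fix x assume "x \<in> {x \<in> carrier H. shift H h g x \<noteq> \<one>\<^bsub>G\<^esub>}"
    then show "x \<in> (\<lambda>x. h \<otimes>\<^bsub>H\<^esub> x) ` Supp G H g"
      using assms(3) by (intro image_eqI[of _ _ "inv\<^bsub>H\<^esub> h \<otimes>\<^bsub>H\<^esub> x"])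
        (auto simp: shift_def Supp_def H.m_assoc[symmetric])
  qed
  then have "finite {x \<in> carrier H. shift H h g x \<noteq> \<one>\<^bsub>G\<^esub>}"
    using fin finite_subset by blast
  then show ?thesis
    using assms g by (auto simp: carrier_sum_group shift_def)
qed

lemma group_wreath:
  assumes "group G" "group H"
  shows "group (wreath G H)"
proof -
  interpret G: group G by fact
  interpret H: group H by fact
  interpret D: group "base_group G H" by (simp add: assms)
  have PiE: "g \<in> (\<Pi>\<^sub>E i\<in>carrier H. carrier G)" if "g \<in> carrier (base_group G H)" for g
    using that by (simp add: carrier_sum_group assms)
  have sm: "shift H h (g \<otimes>\<^bsub>base_group G H\<^esub> g') = shift H h g \<otimes>\<^bsub>base_group G H\<^esub> shift H h g'"
    if "h \<in> carrier H" for g g' h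
    using that by (auto simp: shift_def fun_eq_iff restrict_def)
  have ss: "shift H h (shift H h' g) = shift H (h \<otimes>\<^bsub>H\<^esub> h') g"
    if "h \<in> carrier H" "h' \<in> carrier H" for g h h'
    using that by (auto simp: shift_def fun_eq_iff restrict_def H.inv_mult_group H.m_assoc)
  have s1: "shift H \<one>\<^bsub>H\<^esub> g = g" if "g \<in> carrier (base_group G H)" for g
    using PiE[OF that] by (auto simp: shift_def fun_eq_iff restrict_def PiE_def extensional_def)
  have so: "shift H h \<one>\<^bsub>base_group G H\<^esub> = \<one>\<^bsub>base_group G H\<^esub>" if "h \<in> carrier H" for h
    using that by (auto simp: shift_def fun_eq_iff restrict_def)
  note [simp del] = mult_sum_group one_sum_group
  show ?thesis
  proof (rule groupI)
    fix x assume "x \<in> carrier (wreath G H)"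
    then obtain g h where x: "x = (g, h)" "g \<in> carrier (base_group G H)" "h \<in> carrier H"
      by (auto simp: wreath_def)
    let ?y = "(shift H (inv\<^bsub>H\<^esub> h) (inv\<^bsub>base_group G H\<^esub> g), inv\<^bsub>H\<^esub> h)"
    show "\<exists>y\<in>carrier (wreath G H). y \<otimes>\<^bsub>wreath G H\<^esub> x = \<one>\<^bsub>wreath G H\<^esub>"
    proof (rule bexI[of _ ?y])
      show "?y \<otimes>\<^bsub>wreath G H\<^esub> x = \<one>\<^bsub>wreath G H\<^esub>"
      proof -
        have "shift H (inv\<^bsub>H\<^esub> h) (inv\<^bsub>base_group G H\<^esub> g) \<otimes>\<^bsub>base_group G H\<^esub> shift H (inv\<^bsub>H\<^esub> h) g
            = shift H (inv\<^bsub>H\<^esub> h) (inv\<^bsub>base_group G H\<^esub> g \<otimes>\<^bsub>base_group G H\<^esub> g)"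
          using x by (simp only: sm H.inv_closed)
        also have "\<dots> = \<one>\<^bsub>base_group G H\<^esub>"
          using x by (simp only: D.l_inv so H.inv_closed)
        finally show ?thesis
          unfolding x wreath_def using x by (simp del: inv_sum_group)
      qed
      show "?y \<in> carrier (wreath G H)"
        using x by (simp add: wreath_def shift_base_group assms del: inv_sum_group)
    qed
  qed (auto simp: wreath_def sm ss s1 so D.m_assoc H.m_assoc shift_base_group assms)
qed


section \<open>The sets \<open>E\<close> and \<open>B\<^sub>0\<close>\<close>

definition F0_set ::
  "('g, 'm) monoid_scheme \<Rightarrow> ('h, 'n) monoid_scheme \<Rightarrow> (('h \<Rightarrow> 'g) \<times> 'h) set
    \<Rightarrow> (('h \<Rightarrow> 'g) \<times> 'h) set" where
  "F0_set G H F = F \<union> {\<one>\<^bsub>wreath G H\<^esub>} \<union> (\<lambda>w. inv\<^bsub>wreath G H\<^esub> w) ` F"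

definition E1_set ::
  "('g, 'm) monoid_scheme \<Rightarrow> ('h, 'n) monoid_scheme \<Rightarrow> (('h \<Rightarrow> 'g) \<times> 'h) set \<Rightarrow> ('h \<Rightarrow> 'g) set" where
  "E1_set G H F = {shift H h g |h g. h \<in> snd ` F0_set G H F \<and> g \<in> fst ` F0_set G H F}"

definition E2_set ::
  "('g, 'm) monoid_scheme \<Rightarrow> ('h, 'n) monoid_scheme \<Rightarrow> (('h \<Rightarrow> 'g) \<times> 'h) set \<Rightarrow> 'h set" where
  "E2_set G H F = snd ` F0_set G H F"

definition E_set ::
  "('g, 'm) monoid_scheme \<Rightarrow> ('h, 'n) monoid_scheme \<Rightarrow> (('h \<Rightarrow> 'g) \<times> 'h) set \<Rightarrow> 'h set" where
  "E_set G H F =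
     E2_set G H F \<union> (\<Union>g\<in>E1_set G H F. \<Union>h\<in>E2_set G H F. (\<lambda>x. h \<otimes>\<^bsub>H\<^esub> x) ` Supp G H g)"

definition B01_set :: "'h set \<Rightarrow> 'b set \<Rightarrow> ('h \<Rightarrow> 'b \<Rightarrow> 'b) \<Rightarrow> 'b set" where
  "B01_set E B \<sigma>B = {b \<in> B. \<forall>h1\<in>E. \<forall>h2\<in>E. h1 \<noteq> h2 \<longrightarrow> \<sigma>B h1 b \<noteq> \<sigma>B h2 b}"

definition B02_set ::
  "('h, 'n) monoid_scheme \<Rightarrow> 'h set \<Rightarrow> 'b set \<Rightarrow> ('h \<Rightarrow> 'b \<Rightarrow> 'b) \<Rightarrow> 'b set" where
  "B02_set H E B \<sigma>B =
     {b \<in> B. \<forall>h1\<in>E. \<forall>h2\<in>E. \<sigma>B (h1 \<otimes>\<^bsub>H\<^esub> h2) b = (\<sigma>B h1 \<otimes>\<^bsub>Sym_group B\<^esub> \<sigma>B h2) b}"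

definition B0_set ::
  "('h, 'n) monoid_scheme \<Rightarrow> 'h set \<Rightarrow> 'b set \<Rightarrow> ('h \<Rightarrow> 'b \<Rightarrow> 'b) \<Rightarrow> 'b set" where
  "B0_set H E B \<sigma>B = B01_set E B \<sigma>B \<inter> B02_set H E B \<sigma>B"


section \<open>The map \<open>\<sigma>\<close> on the wreath product\<close>

text \<open>
  Families \<open>(a\<^sub>b)\<^bsub>b\<in>B\<^esub>\<close> in \<open>A\<close> are the elements of \<^term>\<open>B \<rightarrow>\<^sub>E A\<close>.  As elements of a
  \<^const>\<open>Sym_group\<close> all maps are the identity off their set, which is the reason for
  the conditionals on \<^term>\<open>a \<in> B \<rightarrow>\<^sub>E A\<close>.
\<close>

definition coord_perm ::
  "'a set \<Rightarrow> 'b set \<Rightarrow> ('g \<Rightarrow> 'a \<Rightarrow> 'a) \<Rightarrow> ('h \<Rightarrow> 'b \<Rightarrow> 'b) \<Rightarrow> 'b \<Rightarrow> 'h \<Rightarrow> 'g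
    \<Rightarrow> ('b \<Rightarrow> 'a) \<Rightarrow> ('b \<Rightarrow> 'a)" where
  "coord_perm A B \<sigma>A \<sigma>B b0 h g a =
     (if a \<in> B \<rightarrow>\<^sub>E A then (\<lambda>b\<in>B. if b = \<sigma>B h b0 then \<sigma>A g (a b) else a b) else a)"

text \<open>
  The product over \<open>x \<in> E\<close>.  The factors commute for \<^term>\<open>b \<in> B01_set E B \<sigma>B\<close>, and only
  then is the fold meaningful.
\<close>

definition fibre_perm ::
  "'h set \<Rightarrow> 'a set \<Rightarrow> 'b set \<Rightarrow> ('g \<Rightarrow> 'a \<Rightarrow> 'a) \<Rightarrow> ('h \<Rightarrow> 'b \<Rightarrow> 'b) \<Rightarrow> 'b \<Rightarrow> ('h \<Rightarrow> 'g)
    \<Rightarrow> ('b \<Rightarrow> 'a) \<Rightarrow> ('b \<Rightarrow> 'a)" where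
  "fibre_perm E A B \<sigma>A \<sigma>B b g =
     Finite_Set.fold
       (\<lambda>x p. coord_perm A B \<sigma>A \<sigma>B b x (g x) \<otimes>\<^bsub>Sym_group (B \<rightarrow>\<^sub>E A)\<^esub> p)
       \<one>\<^bsub>Sym_group (B \<rightarrow>\<^sub>E A)\<^esub> E"

definition hat_A ::
  "('g, 'm) monoid_scheme \<Rightarrow> ('h, 'n) monoid_scheme \<Rightarrow> 'h set \<Rightarrow> 'a set \<Rightarrow> 'b set
    \<Rightarrow> ('g \<Rightarrow> 'a \<Rightarrow> 'a) \<Rightarrow> ('h \<Rightarrow> 'b \<Rightarrow> 'b) \<Rightarrow> ('h \<Rightarrow> 'g)
    \<Rightarrow> ('b \<Rightarrow> 'a) \<times> 'b \<Rightarrow> ('b \<Rightarrow> 'a) \<times> 'b" where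
  "hat_A G H E A B \<sigma>A \<sigma>B g =
     (if Supp G H g \<subseteq> E
      then (\<lambda>(a, b). if b \<in> B0_set H E B \<sigma>B then (fibre_perm E A B \<sigma>A \<sigma>B b g a, b) else (a, b))
      else id)"

definition hat_B ::
  "'a set \<Rightarrow> 'b set \<Rightarrow> ('h \<Rightarrow> 'b \<Rightarrow> 'b) \<Rightarrow> 'h \<Rightarrow> ('b \<Rightarrow> 'a) \<times> 'b \<Rightarrow> ('b \<Rightarrow> 'a) \<times> 'b" where
  "hat_B A B \<sigma>B h = (\<lambda>(a, b). if a \<in> B \<rightarrow>\<^sub>E A then (a, \<sigma>B h b) else (a, b))"

definition hat_sigma ::
  "('g, 'm) monoid_scheme \<Rightarrow> ('h, 'n) monoid_scheme \<Rightarrow> (('h \<Rightarrow> 'g) \<times> 'h) set \<Rightarrow> 'a set \<Rightarrow> 'b set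
    \<Rightarrow> ('g \<Rightarrow> 'a \<Rightarrow> 'a) \<Rightarrow> ('h \<Rightarrow> 'b \<Rightarrow> 'b) \<Rightarrow> ('h \<Rightarrow> 'g) \<times> 'h
    \<Rightarrow> ('b \<Rightarrow> 'a) \<times> 'b \<Rightarrow> ('b \<Rightarrow> 'a) \<times> 'b" where
  "hat_sigma G H F A B \<sigma>A \<sigma>B = (\<lambda>(g, h).
     hat_A G H (E_set G H F) A B \<sigma>A \<sigma>B g \<otimes>\<^bsub>Sym_group ((B \<rightarrow>\<^sub>E A) \<times> B)\<^esub> hat_B A B \<sigma>B h)"

end

theory Submission
  imports Defs
begin

text \<open>
  Over a base point \<open>b \<in> B\<^sub>0\<close> the fibre permutation of \<open>g\<close> acts on the coordinate \<open>\<sigma>\<^sub>B(x) b\<close> by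
  \<open>\<sigma>\<^sub>A(g\<^sub>x)\<close>, for \<open>x \<in> E\<close>, and trivially on all other coordinates.  If \<open>b\<close> and \<open>\<sigma>\<^sub>B(h) b\<close> lie in
  \<open>B\<^sub>0\<close>, the coordinates used by \<open>g'\<close> over \<open>\<sigma>\<^sub>B(h) b\<close> are those used by \<open>\<alpha>\<^sub>h g'\<close> over \<open>b\<close>, so
  that multiplicativity at \<open>(a, b)\<close> can only fail when \<open>\<sigma>\<^sub>A\<close> fails to be multiplicative at one of
  the coordinates \<open>a\<^bsub>\<sigma>\<^sub>B(x) b\<^esub>\<close>; for fixed \<open>b\<close> these are at most \<open>|E| \<epsilon>'\<close> of all families \<open>a\<close>.
  The complement of \<open>B\<^sub>0\<close> has density at most \<open>4 |E|\<^sup>2 \<epsilon>'\<close>: when \<open>\<sigma>\<^sub>B\<close> is multiplicative at \<open>b\<close>,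
  a coincidence \<open>\<sigma>\<^sub>B(h\<^sub>1) b = \<sigma>\<^sub>B(h\<^sub>2) b\<close> makes \<open>b\<close> a fixed point of \<open>\<sigma>\<^sub>B(h\<^sub>1 h\<^sub>2\<^sup>-\<^sup>1)\<close>.
\<close>

section \<open>Hamming distances and sofic approximations\<close>

lemma hamming_dist_less_iff:
  assumes "finite A" "A \<noteq> {}"
  shows "hamming_dist A \<sigma> \<tau> < \<epsilon> \<longleftrightarrow> real (card {a \<in> A. \<sigma> a \<noteq> \<tau> a}) < \<epsilon> * real (card A)"
  using assms by (simp add: hamming_dist_def divide_less_eq card_gt_0_iff)

text \<open>Moved points and fixed points partition \<open>A\<close>, so freeness becomes an upper
  bound on the number of fixed points. Both soficity conditions are then bounds on sets of bad
  points, which add up under unions.\<close>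

lemma hamming_dist_id_greater_iff:
  assumes "finite A" "A \<noteq> {}"
  shows "hamming_dist A \<sigma> id > 1 - \<epsilon> \<longleftrightarrow> real (card {a \<in> A. \<sigma> a = a}) < \<epsilon> * real (card A)"
proof -
  have "A = {a \<in> A. \<sigma> a \<noteq> a} \<union> {a \<in> A. \<sigma> a = a}"
    by blast
  then have "card A = card {a \<in> A. \<sigma> a \<noteq> a} + card {a \<in> A. \<sigma> a = a}"
    using card_Un_disjoint[of "{a \<in> A. \<sigma> a \<noteq> a}" "{a \<in> A. \<sigma> a = a}"] assms(1) by auto
  moreover have "card A > 0"
    using assms by (simp add: card_gt_0_iff)
  ultimately show ?thesis
    by (simp add: hamming_dist_def less_divide_eq left_diff_distrib) linarith
qed

text \<open>Working form without divisions. The left factor acts first in \<open>Sym_group\<close>,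
  hence the order in \<open>\<sigma> h (\<sigma> g a)\<close>.\<close>

lemma sofic_approximation_iff:
  assumes "finite A" "A \<noteq> {}"
  shows "sofic_approximation \<Gamma> F \<epsilon> A \<sigma> \<longleftrightarrow>
    (\<forall>g\<in>carrier \<Gamma>. \<sigma> g permutes A) \<and>
    (\<forall>g\<in>F. \<forall>h\<in>F. real (card {a \<in> A. \<sigma> h (\<sigma> g a) \<noteq> \<sigma> (g \<otimes>\<^bsub>\<Gamma>\<^esub> h) a}) < \<epsilon> * real (card A)) \<and>
    (\<forall>g\<in>F - {\<one>\<^bsub>\<Gamma>\<^esub>}. real (card {a \<in> A. \<sigma> g a = a}) < \<epsilon> * real (card A)) \<and>
    \<sigma> \<one>\<^bsub>\<Gamma>\<^esub> = id"
  unfolding sofic_approximation_def sofic_multiplicative_def sofic_free_def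
  using assms by (simp add: Sym_group_def hamming_dist_less_iff hamming_dist_id_greater_iff Pi_iff)

section \<open>Counting by union bounds, fibres and single coordinates\<close>

lemma card_UN_le_mult:
  fixes \<delta> :: real
  assumes "finite I" "\<And>i. i \<in> I \<Longrightarrow> real (card (D i)) \<le> \<delta>"
  shows "real (card (\<Union>i\<in>I. D i)) \<le> real (card I) * \<delta>"
proof -
  have "real (card (\<Union>i\<in>I. D i)) \<le> (\<Sum>i\<in>I. real (card (D i)))"
    using card_UN_le[OF assms(1)] by (metis of_nat_le_iff of_nat_sum)
  also have "\<dots> \<le> real (card I) * \<delta>"
    using assms(2) by (intro sum_bounded_above)
  finally show ?thesis .
qed

text \<open>Fibres over the exceptional base points \<open>B'\<close> are counted in full, which
  costs \<open>\<eta>\<close>; each remaining fibre has density at most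
  \<open>\<delta>\<close>.\<close>

lemma card_fibrewise_le:
  fixes \<delta> \<eta> :: real
  assumes "finite P" "finite B" "D \<subseteq> P \<times> B" "B' \<subseteq> B" "\<delta> \<ge> 0"
    and B': "real (card B') \<le> \<eta> * real (card B)"
    and fib: "\<And>b. b \<in> B - B' \<Longrightarrow> real (card {a \<in> P. (a, b) \<in> D}) \<le> \<delta> * real (card P)"
  shows "real (card D) \<le> (\<delta> + \<eta>) * real (card (P \<times> B))"
proof -
  let ?D = "\<Union>b\<in>B - B'. {a \<in> P. (a, b) \<in> D} \<times> {b}"
  have "finite B'"
    using assms finite_subset by blast
  have "D \<subseteq> P \<times> B' \<union> ?D"
    using assms(3) by auto
  moreover have "finite (P \<times> B' \<union> ?D)"
    using assms \<open>finite B'\<close> by auto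
  ultimately have "card D \<le> card (P \<times> B') + card ?D"
    by (intro order_trans[OF card_mono card_Un_le])
  then have "real (card D) \<le> real (card P) * real (card B') + real (card ?D)"
    by (simp add: card_cartesian_product flip: of_nat_mult of_nat_add)
  also have "real (card ?D) \<le> real (card (B - B')) * (\<delta> * real (card P))"
    using assms by (intro card_UN_le_mult) (auto simp: card_cartesian_product)
  also have "\<dots> \<le> real (card B) * (\<delta> * real (card P))"
    using assms by (intro mult_right_mono) (auto intro: card_mono)
  also have "real (card P) * real (card B') \<le> real (card P) * (\<eta> * real (card B))"
    using B' by (intro mult_left_mono) auto
  finally show ?thesis
    by (simp add: card_cartesian_product algebra_simps)
qed

text \<open>A single coordinate of a uniformly random family is uniformly distributed in
  \<open>A\<close>; the equality of densities is multiplied out to avoid division.\<close>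

lemma card_PiE_coordinate:
  assumes "finite B" "c \<in> B"
  shows "card {a \<in> B \<rightarrow>\<^sub>E A. P (a c)} * card A = card {\<alpha> \<in> A. P \<alpha>} * card (B \<rightarrow>\<^sub>E A)"
proof -
  \<comment> \<open>A condition on one coordinate cuts out a product set again, whose cardinality is
    a product over \<open>B\<close>.\<close>
  have eq: "{a \<in> B \<rightarrow>\<^sub>E A. P (a c)} = (\<Pi>\<^sub>E d\<in>B. if d = c then {\<alpha> \<in> A. P \<alpha>} else A)"
    using assms(2) by (fastforce simp: PiE_iff split: if_splits)
  have "card {a \<in> B \<rightarrow>\<^sub>E A. P (a c)} = card {\<alpha> \<in> A. P \<alpha>} * (\<Prod>d\<in>B - {c}. card A)"
    unfolding eq using assms
    by (simp add: card_PiE prod.remove[of B c])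
  moreover have "card (B \<rightarrow>\<^sub>E A) = card A * (\<Prod>d\<in>B - {c}. card A)"
    using assms by (simp only: card_PiE prod.remove)
  ultimately show ?thesis
    by (simp add: mult.assoc mult.commute)
qed

lemma card_PiE_coordinate_le:
  fixes \<delta> :: real
  assumes "finite A" "A \<noteq> {}" "finite B" "c \<in> B"
    and "real (card {\<alpha> \<in> A. P \<alpha>}) \<le> \<delta> * real (card A)"
  shows "real (card {a \<in> B \<rightarrow>\<^sub>E A. P (a c)}) \<le> \<delta> * real (card (B \<rightarrow>\<^sub>E A))"
proof -
  have "real (card {a \<in> B \<rightarrow>\<^sub>E A. P (a c)}) * real (card A)
      = real (card {\<alpha> \<in> A. P \<alpha>}) * real (card (B \<rightarrow>\<^sub>E A))"
    using card_PiE_coordinate[OF assms(3,4), of A P] by (simp flip: of_nat_mult)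
  also have "\<dots> \<le> \<delta> * real (card A) * real (card (B \<rightarrow>\<^sub>E A))"
    using assms(5) by (intro mult_right_mono) auto
  finally have "real (card {a \<in> B \<rightarrow>\<^sub>E A. P (a c)}) * real (card A)
      \<le> (\<delta> * real (card (B \<rightarrow>\<^sub>E A))) * real (card A)"
    by (simp add: mult_ac)
  moreover have "card A > 0"
    using assms by (simp add: card_gt_0_iff)
  ultimately show ?thesis
    by simp
qed

section \<open>Coordinatewise permutations\<close>

text \<open>The action on families of an element \<open>q\<close> of the direct product of copies of
  \<open>Sym(A)\<close>, extended by the identity as \<open>Sym_group\<close> requires. Fibre
  permutations are brought into this form, so that they can be compared coordinate by
  coordinate.\<close>

definition coordwise :: "'a set \<Rightarrow> 'b set \<Rightarrow> ('b \<Rightarrow> 'a \<Rightarrow> 'a) \<Rightarrow> ('b \<Rightarrow> 'a) \<Rightarrow> 'b \<Rightarrow> 'a" where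
  "coordwise A B q a = (if a \<in> B \<rightarrow>\<^sub>E A then (\<lambda>c\<in>B. q c (a c)) else a)"

lemma coordwise_PiE:
  assumes "\<And>c. c \<in> B \<Longrightarrow> q c permutes A" "a \<in> B \<rightarrow>\<^sub>E A"
  shows "coordwise A B q a \<in> B \<rightarrow>\<^sub>E A"
  using assms(2) by (simp add: coordwise_def PiE_iff permutes_in_image[OF assms(1)])

text \<open>The inner map keeps a family inside \<open>B \<rightarrow>\<^sub>E A\<close>, so both
  conditionals take the same branch.\<close>

lemma coordwise_comp:
  assumes "\<And>c. c \<in> B \<Longrightarrow> r c permutes A"
  shows "coordwise A B q \<circ> coordwise A B r = coordwise A B (\<lambda>c. q c \<circ> r c)"
proof
  fix a
  show "(coordwise A B q \<circ> coordwise A B r) a = coordwise A B (\<lambda>c. q c \<circ> r c) a"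
    using coordwise_PiE[of B r A a] assms
    by (cases "a \<in> B \<rightarrow>\<^sub>E A") (auto simp: coordwise_def fun_eq_iff)
qed

lemma coordwise_id: "coordwise A B (\<lambda>c. id) = id"
  by (auto simp: coordwise_def fun_eq_iff PiE_iff extensional_def)

lemma coordwise_cong:
  assumes "\<And>c. c \<in> B \<Longrightarrow> q c = r c"
  shows "coordwise A B q = coordwise A B r"
  by (rule ext) (simp add: coordwise_def assms cong: restrict_cong)

text \<open>The two-sided inverse is obtained by inverting every coordinate.\<close>

lemma coordwise_permutes:
  assumes q: "\<And>c. c \<in> B \<Longrightarrow> q c permutes A"
  shows "coordwise A B q permutes (B \<rightarrow>\<^sub>E A)"
proof (rule bij_imp_permutes)
  let ?i = "coordwise A B (\<lambda>c. inv_into UNIV (q c))"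
  have i: "inv_into UNIV (q c) permutes A" if "c \<in> B" for c
    using q[OF that] by (rule permutes_inv)
  have inverses: "inv_into UNIV (q c) \<circ> q c = id" "q c \<circ> inv_into UNIV (q c) = id" if "c \<in> B" for c
    using permutes_inv_o[OF q[OF that]] by auto
  have "?i \<circ> coordwise A B q = coordwise A B (\<lambda>c. inv_into UNIV (q c) \<circ> q c)"
    by (rule coordwise_comp[OF q])
  also have "\<dots> = id"
    unfolding coordwise_id[symmetric, of A B] by (rule coordwise_cong[OF inverses(1)])
  finally have 1: "?i \<circ> coordwise A B q = id" .
  have "coordwise A B q \<circ> ?i = coordwise A B (\<lambda>c. q c \<circ> inv_into UNIV (q c))"
    by (rule coordwise_comp[OF i])
  also have "\<dots> = id"
    unfolding coordwise_id[symmetric, of A B] by (rule coordwise_cong[OF inverses(2)])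
  finally have 2: "coordwise A B q \<circ> ?i = id" .
  show "bij_betw (coordwise A B q) (B \<rightarrow>\<^sub>E A) (B \<rightarrow>\<^sub>E A)"
    using coordwise_PiE[of B q A, OF q] coordwise_PiE[of B "\<lambda>c. inv_into UNIV (q c)" A, OF i]
    by (intro bij_betw_byWitness[of _ ?i] ballI image_subsetI pointfree_idE[OF 1] pointfree_idE[OF 2])
qed (simp add: coordwise_def)

lemma coordwise_disjoint_commute:
  assumes "\<And>c. c \<in> B \<Longrightarrow> q c permutes A" "\<And>c. c \<in> B \<Longrightarrow> r c permutes A"
    and "\<And>c. c \<in> B \<Longrightarrow> q c = id \<or> r c = id"
  shows "coordwise A B q \<circ> coordwise A B r = coordwise A B r \<circ> coordwise A B q"
proof -
  have "coordwise A B (\<lambda>c. q c \<circ> r c) = coordwise A B (\<lambda>c. r c \<circ> q c)"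
    using assms(3) by (intro coordwise_cong) fastforce
  then show ?thesis
    using assms by (simp only: coordwise_comp)
qed

lemma coord_perm_eq_coordwise:
  "coord_perm A B \<sigma>A \<sigma>B b x g = coordwise A B (\<lambda>c. if c = \<sigma>B x b then \<sigma>A g else id)"
  by (auto simp: coord_perm_def coordwise_def fun_eq_iff)

text \<open>By injectivity each coordinate is touched by at most one factor of the product over
  \<open>E\<close>, and \<open>inv_into\<close> recovers the index of that factor. This replaces the
  fold by a closed formula.\<close>

lemma fibre_perm_eq_coordwise:
  fixes A :: "'a set" and B :: "'b set"
  assumes "finite E" and inj: "inj_on (\<lambda>x. \<sigma>B x b) E"
    and perm: "\<And>x. x \<in> E \<Longrightarrow> \<sigma>A (g x) permutes A"
  shows "fibre_perm E A B \<sigma>A \<sigma>B b g =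
    coordwise A B (\<lambda>c. if c \<in> (\<lambda>x. \<sigma>B x b) ` E then \<sigma>A (g (inv_into E (\<lambda>x. \<sigma>B x b) c)) else id)"
proof -
  let ?s = "\<lambda>x. \<sigma>B x b"
  define k where "k x = coordwise A B (\<lambda>c. if c = ?s x then \<sigma>A (g x) else id)" for x
  define f where "f x p = p \<circ> k x" for x and p :: "('b \<Rightarrow> 'a) \<Rightarrow> 'b \<Rightarrow> 'a"
  have comm: "k x \<circ> k y = k y \<circ> k x" if "x \<in> E" "y \<in> E" for x y
  proof (cases "x = y")
    case False
    then have "?s x \<noteq> ?s y"
      using inj that by (auto dest: inj_onD)
    then show ?thesis
      unfolding k_def using that perm by (intro coordwise_disjoint_commute) (auto simp: permutes_id)
  qed auto
  \<comment> \<open>Distinct factors act on distinct coordinates and therefore commute, which makes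
    the fold independent of the order of \<open>E\<close>.\<close>
  interpret comp_fun_commute_on E f
    by unfold_locales (rule ext, simp only: f_def o_apply comp_assoc comm)
  \<comment> \<open>The induction runs over subsets \<open>E'\<close>, but the inverse is taken on
    all of \<open>E\<close>, so the formula for old coordinates does not change when
    \<open>E'\<close> grows.\<close>
  have "Finite_Set.fold f id E' =
      coordwise A B (\<lambda>c. if c \<in> ?s ` E' then \<sigma>A (g (inv_into E ?s c)) else id)"
    if "E' \<subseteq> E" "finite E'" for E'
    using that(2,1)
  proof (induction E' rule: finite_induct)
    case empty
    show ?case
      by (simp only: fold_empty image_empty empty_iff if_False coordwise_id)
  next
    case (insert x E')
    then have x: "x \<in> E" "?s x \<notin> ?s ` E'" "inv_into E ?s (?s x) = x"
      using inj inv_into_f_f[OF inj, of x] by (auto dest: inj_onD)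
    have IH: "Finite_Set.fold f id E' =
        coordwise A B (\<lambda>c. if c \<in> ?s ` E' then \<sigma>A (g (inv_into E ?s c)) else id)"
      using insert by blast
    have "Finite_Set.fold f id (insert x E') = f x (Finite_Set.fold f id E')"
      using insert by (intro fold_insert) auto
    also have "\<dots> =
        coordwise A B (\<lambda>c. if c \<in> ?s ` E' then \<sigma>A (g (inv_into E ?s c)) else id) \<circ> k x"
      by (simp only: IH f_def)
    also have "\<dots> = coordwise A B (\<lambda>c. (if c \<in> ?s ` E' then \<sigma>A (g (inv_into E ?s c)) else id)
        \<circ> (if c = ?s x then \<sigma>A (g x) else id))"
      unfolding k_def using perm[OF x(1)] by (intro coordwise_comp) (auto simp: permutes_id)
    also have "\<dots> = coordwise A B
        (\<lambda>c. if c \<in> ?s ` insert x E' then \<sigma>A (g (inv_into E ?s c)) else id)"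
      using x by (intro coordwise_cong) auto
    finally show ?case .
  qed
  moreover have "fibre_perm E A B \<sigma>A \<sigma>B b g = Finite_Set.fold f id E"
    unfolding fibre_perm_def f_def[abs_def] k_def[abs_def]
    by (simp add: Sym_group_def coord_perm_eq_coordwise del: id_apply)
  ultimately show ?thesis
    using \<open>finite E\<close> by simp
qed

section \<open>The density of the complement of \<open>B\<^sub>0\<close>\<close>

text \<open>The finite set on which \<open>\<sigma>B\<close> is tested: \<open>E\<close> controls
  \<open>B02_set\<close>, the inverses turn a coincidence of two images of \<open>b\<close> into a
  fixed point, and freeness is applied to the quotients.\<close>

definition quotients :: "('h, 'n) monoid_scheme \<Rightarrow> 'h set \<Rightarrow> 'h set" where
  "quotients H E = E \<union> m_inv H ` E \<union> (\<lambda>(x, y). x \<otimes>\<^bsub>H\<^esub> inv\<^bsub>H\<^esub> y) ` (E \<times> E)"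

lemma (in group) finite_quotients: "finite E \<Longrightarrow> finite (quotients G E)"
  by (simp add: quotients_def)

lemma (in group) quotients_subset: "E \<subseteq> carrier G \<Longrightarrow> quotients G E \<subseteq> carrier G"
  by (auto simp: quotients_def)

text \<open>Each of the \<open>card E ^ 2\<close> pairs excludes at most four sets of density
  \<open>\<delta>\<close>: three multiplicativity defects and one set of fixed points.\<close>

lemma card_complement_B0_le:
  fixes \<delta> :: real
  assumes "group H" "finite B" "B \<noteq> {}" "finite E" "E \<subseteq> carrier H" "\<delta> \<ge> 0"
    and sofic: "sofic_approximation H (quotients H E) \<delta> B \<sigma>"
  shows "real (card (B - B0_set H E B \<sigma>)) \<le> 4 * real (card E) ^ 2 * \<delta> * real (card B)"
proof -
  interpret H: group H by fact
  let ?Q = "quotients H E"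
  define M where "M x y = {b \<in> B. \<sigma> y (\<sigma> x b) \<noteq> \<sigma> (x \<otimes>\<^bsub>H\<^esub> y) b}" for x y
  define Fix where "Fix x = {b \<in> B. \<sigma> x b = b}" for x
  \<comment> \<open>The diagonal is left out of the fixed-point part: there the quotient is the
    identity, which fixes every point.\<close>
  define D where "D = (\<lambda>(x, y). M x y \<union> M x (inv\<^bsub>H\<^esub> y) \<union> M y (inv\<^bsub>H\<^esub> y) \<union>
    (if x = y then {} else Fix (x \<otimes>\<^bsub>H\<^esub> inv\<^bsub>H\<^esub> y)))"
  note sofic' = sofic[unfolded sofic_approximation_iff[OF assms(2,3)]]
  have M: "real (card (M x y)) \<le> \<delta> * real (card B)" if "x \<in> ?Q" "y \<in> ?Q" for x y
    using sofic' that less_imp_le unfolding M_def by blast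
  have Fix: "real (card (Fix x)) \<le> \<delta> * real (card B)" if "x \<in> ?Q" "x \<noteq> \<one>\<^bsub>H\<^esub>" for x
    using sofic' that less_imp_le unfolding Fix_def by blast
  have one: "\<sigma> \<one>\<^bsub>H\<^esub> = id"
    using sofic' by blast
  have D: "real (card (D p)) \<le> 4 * \<delta> * real (card B)" if p: "p \<in> E \<times> E" for p
  proof -
    obtain x y where xy: "p = (x, y)" "x \<in> E" "y \<in> E"
      using p by auto
    then have Q: "x \<in> ?Q" "y \<in> ?Q" "inv\<^bsub>H\<^esub> y \<in> ?Q" "x \<otimes>\<^bsub>H\<^esub> inv\<^bsub>H\<^esub> y \<in> ?Q"
      by (auto simp: quotients_def)
    have cl: "x \<in> carrier H" "y \<in> carrier H"
      using xy assms(5) by auto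
    let ?F = "if x = y then {} else Fix (x \<otimes>\<^bsub>H\<^esub> inv\<^bsub>H\<^esub> y)"
    have "x \<otimes>\<^bsub>H\<^esub> inv\<^bsub>H\<^esub> y \<noteq> \<one>\<^bsub>H\<^esub>" if "x \<noteq> y"
      using that cl H.inv_equality[of x "inv\<^bsub>H\<^esub> y"] by auto
    then have "real (card ?F) \<le> \<delta> * real (card B)"
      using Fix[OF Q(4)] assms(6) by auto
    moreover have "card (D p) \<le> card (M x y) + card (M x (inv\<^bsub>H\<^esub> y)) + card (M y (inv\<^bsub>H\<^esub> y)) + card ?F"
      unfolding D_def xy(1) case_prod_conv
      by (intro order_trans[OF card_Un_le] add_mono order_refl)
    ultimately show ?thesis
      using M[OF Q(1,2)] M[OF Q(1,3)] M[OF Q(2,3)] by linarith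
  qed
  have "B - B0_set H E B \<sigma> \<subseteq> (\<Union>p\<in>E \<times> E. D p)"
  proof
    fix b assume b: "b \<in> B - B0_set H E B \<sigma>"
    consider x y where "x \<in> E" "y \<in> E" "x \<noteq> y" "\<sigma> x b = \<sigma> y b"
      | x y where "x \<in> E" "y \<in> E" "\<sigma> (x \<otimes>\<^bsub>H\<^esub> y) b \<noteq> \<sigma> y (\<sigma> x b)"
      using b by (auto simp: B0_set_def B01_set_def B02_set_def Sym_group_def)
    then show "b \<in> (\<Union>p\<in>E \<times> E. D p)"
    proof cases
      case 1
      \<comment> \<open>Applying \<open>\<sigma> (inv y)\<close> to
        \<open>\<sigma> x b = \<sigma> y b\<close> gives \<open>\<sigma> (x * inv y) b\<close> on
        the left and \<open>\<sigma> 1 b = b\<close> on the right, because multiplicativity holds at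
        \<open>b\<close> for both pairs.\<close>
      have "b \<in> Fix (x \<otimes>\<^bsub>H\<^esub> inv\<^bsub>H\<^esub> y)" if "b \<notin> M x (inv\<^bsub>H\<^esub> y)" "b \<notin> M y (inv\<^bsub>H\<^esub> y)"
      proof -
        have "y \<in> carrier H"
          using 1 assms(5) by auto
        then show ?thesis
          using that b 1(4) one by (auto simp: M_def Fix_def)
      qed
      with 1 have "b \<in> D (x, y)"
        by (auto simp: D_def)
      with 1 show ?thesis by blast
    next
      case 2
      with b have "b \<in> D (x, y)"
        by (auto simp: D_def M_def)
      with 2 show ?thesis by blast
    qed
  qed
  moreover have "finite (\<Union>p\<in>E \<times> E. D p)"
    using assms(2,4) by (auto simp: D_def M_def Fix_def)
  ultimately have "real (card (B - B0_set H E B \<sigma>)) \<le> real (card (\<Union>p\<in>E \<times> E. D p))"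
    by (simp add: card_mono)
  also have "\<dots> \<le> real (card (E \<times> E)) * (4 * \<delta> * real (card B))"
    using assms(4) D by (intro card_UN_le_mult) auto
  finally show ?thesis
    by (simp add: card_cartesian_product power2_eq_square mult_ac)
qed


section \<open>The set \<open>E\<close>\<close>

locale wreath_finite_subset = G: group G + H: group H
  for G :: "('g, 'm) monoid_scheme" and H :: "('h, 'n) monoid_scheme" +
  fixes F :: "(('h \<Rightarrow> 'g) \<times> 'h) set"
  assumes finite_F: "finite F" and F_subset: "F \<subseteq> carrier (wreath G H)"
begin

abbreviation "E \<equiv> E_set G H F"

lemma base_group_closed: "g \<in> carrier (base_group G H) \<Longrightarrow> x \<in> carrier H \<Longrightarrow> g x \<in> carrier G"
  by (auto simp: carrier_sum_group G.is_group)

lemma base_group_extensional: "g \<in> carrier (base_group G H) \<Longrightarrow> g \<in> extensional (carrier H)"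
  by (auto simp: carrier_sum_group G.is_group PiE_def)

lemma finite_Supp: "g \<in> carrier (base_group G H) \<Longrightarrow> finite (Supp G H g)"
  by (simp add: carrier_sum_group G.is_group Supp_def)

lemma F_memD:
  assumes "(g, h) \<in> F"
  shows "g \<in> carrier (base_group G H)" "h \<in> carrier H"
  using assms F_subset by (auto simp: wreath_def)

lemma F0_subset: "F0_set G H F \<subseteq> carrier (wreath G H)"
proof -
  interpret W: group "wreath G H"
    by (intro group_wreath G.is_group H.is_group)
  show ?thesis
    using F_subset by (auto simp: F0_set_def)
qed

lemma finite_F0: "finite (F0_set G H F)"
  by (simp add: F0_set_def finite_F)

lemma shift_one: "g \<in> carrier (base_group G H) \<Longrightarrow> shift H \<one>\<^bsub>H\<^esub> g = g"
  using base_group_extensional[of g]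
  by (auto simp: shift_def fun_eq_iff restrict_def extensional_def)

lemma E1_subset: "E1_set G H F \<subseteq> carrier (base_group G H)"
proof -
  have "h \<in> carrier H" "g \<in> carrier (base_group G H)"
    if "h \<in> snd ` F0_set G H F" "g \<in> fst ` F0_set G H F" for g h
    using that F0_subset by (auto simp: wreath_def)
  then show ?thesis
    unfolding E1_set_def using shift_base_group[OF G.is_group H.is_group] by blast
qed

lemma E_subset: "E \<subseteq> carrier H"
proof -
  have "E2_set G H F \<subseteq> carrier H"
    using F0_subset by (auto simp: E2_set_def wreath_def)
  then show ?thesis
    by (auto simp: E_set_def Supp_def)
qed

lemma finite_E: "finite E"
proof -
  have "E1_set G H F = (\<lambda>(h, g). shift H h g) ` (snd ` F0_set G H F \<times> fst ` F0_set G H F)"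
    by (auto simp: E1_set_def)
  then have "finite (E1_set G H F)"
    using finite_F0 by simp
  moreover have "finite (E2_set G H F)"
    using finite_F0 by (simp add: E2_set_def)
  ultimately show ?thesis
    using E1_subset finite_Supp by (auto simp: E_set_def)
qed

lemma one_in_E2: "\<one>\<^bsub>H\<^esub> \<in> E2_set G H F"
  by (force simp: E2_set_def F0_set_def wreath_def)

lemma E_nonempty: "E \<noteq> {}"
  using one_in_E2 by (auto simp: E_set_def)

lemma snd_in_E2: "(g, h) \<in> F \<Longrightarrow> h \<in> E2_set G H F"
  by (force simp: E2_set_def F0_set_def)

lemma snd_in_E: "(g, h) \<in> F \<Longrightarrow> h \<in> E"
  using snd_in_E2 by (auto simp: E_set_def)

text \<open>\<open>F0_set\<close> contains the identity, so the shift by \<open>1\<close> is among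
  those defining \<open>E1_set\<close>.\<close>

lemma fst_in_E1:
  assumes "(g, h) \<in> F"
  shows "g \<in> E1_set G H F"
proof -
  have "shift H \<one>\<^bsub>H\<^esub> g \<in> E1_set G H F"
    using assms one_in_E2 by (force simp: E1_set_def E2_set_def F0_set_def)
  then show ?thesis
    using F_memD[OF assms] by (simp add: shift_one)
qed

text \<open>This is what the translates in \<open>E_set\<close> are for: \<open>h * x\<close> with
  \<open>x\<close> in the support of \<open>g'\<close> are the positions occupied by
  \<open>g'\<close> after the shift by \<open>h\<close>.\<close>

lemma mult_Supp_in_E:
  assumes "(g, h) \<in> F" "(g', h') \<in> F" "x \<in> Supp G H g'"
  shows "h \<otimes>\<^bsub>H\<^esub> x \<in> E"
  using fst_in_E1[OF assms(2)] snd_in_E2[OF assms(1)] assms(3) by (auto simp: E_set_def)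

lemma Supp_subset_E:
  assumes "(g, h) \<in> F"
  shows "Supp G H g \<subseteq> E"
proof
  fix x assume x: "x \<in> Supp G H g"
  then have "\<one>\<^bsub>H\<^esub> \<otimes>\<^bsub>H\<^esub> x \<in> E"
    using fst_in_E1[OF assms] one_in_E2 by (auto simp: E_set_def)
  then show "x \<in> E"
    using x by (simp add: Supp_def)
qed

end

section \<open>The map \<open>\<sigma>\<close> on the wreath product\<close>

text \<open>The base point is preserved, so the inverse can be taken in each fibre
  separately.\<close>

lemma permutes_fibrewise:
  assumes f: "\<And>b. b \<in> B' \<Longrightarrow> f b permutes P" and "B' \<subseteq> B"
  shows "(\<lambda>(a, b). if b \<in> B' then (f b a, b) else (a, b)) permutes P \<times> B"
proof (rule bij_imp_permutes)
  let ?i = "\<lambda>(a, b). if b \<in> B' then (inv_into UNIV (f b) a, b) else (a, b)"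
  show "bij_betw (\<lambda>(a, b). if b \<in> B' then (f b a, b) else (a, b)) (P \<times> B) (P \<times> B)"
    by (rule bij_betw_byWitness[of _ ?i])
      (auto simp: permutes_inverses[OF f] permutes_in_image[OF f]
        permutes_in_image[OF permutes_inv[OF f]] split: if_splits)
next
  fix p assume "p \<notin> P \<times> B"
  then show "(\<lambda>(a, b). if b \<in> B' then (f b a, b) else (a, b)) p = p"
    using assms(2) by (cases p) (auto simp: permutes_not_in[OF f])
qed

lemma hat_B_permutes:
  assumes q: "\<sigma>B h permutes B"
  shows "hat_B A B \<sigma>B h permutes (B \<rightarrow>\<^sub>E A) \<times> B"
proof (rule bij_imp_permutes)
  show "bij_betw (hat_B A B \<sigma>B h) ((B \<rightarrow>\<^sub>E A) \<times> B) ((B \<rightarrow>\<^sub>E A) \<times> B)"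
    by (rule bij_betw_byWitness[of _ "\<lambda>(a, b). (a, inv_into UNIV (\<sigma>B h) b)"])
      (auto simp: hat_B_def permutes_inverses[OF q] permutes_in_image[OF q]
        permutes_in_image[OF permutes_inv[OF q]])
next
  fix p assume "p \<notin> (B \<rightarrow>\<^sub>E A) \<times> B"
  then show "hat_B A B \<sigma>B h p = p"
    by (cases p) (auto simp: hat_B_def permutes_not_in[OF q])
qed

text \<open>The finite test set for \<open>\<sigma>A\<close>. It contains \<open>1\<close>, the
  value of every family off its support, so that it covers all coordinates of elements of
  \<open>F\<close>.\<close>

definition coordinate_values ::
  "('g, 'm) monoid_scheme \<Rightarrow> ('h, 'n) monoid_scheme \<Rightarrow> (('h \<Rightarrow> 'g) \<times> 'h) set \<Rightarrow> 'g set" where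
  "coordinate_values G H F = insert \<one>\<^bsub>G\<^esub> (\<Union>g\<in>fst ` F. g ` Supp G H g)"

context wreath_finite_subset
begin

lemma finite_coordinate_values: "finite (coordinate_values G H F)"
  using finite_F finite_Supp F_memD by (auto simp: coordinate_values_def)

lemma coordinate_values_subset: "coordinate_values G H F \<subseteq> carrier G"
  using F_memD base_group_closed by (fastforce simp: coordinate_values_def Supp_def)

lemma coordinate_values_memI:
  assumes "(g, h) \<in> F" "x \<in> carrier H"
  shows "g x \<in> coordinate_values G H F"
proof (cases "g x = \<one>\<^bsub>G\<^esub>")
  case False
  then have "x \<in> Supp G H g"
    using assms by (simp add: Supp_def)
  then show ?thesis
    using assms(1) by (force simp: coordinate_values_def)
qed (simp add: coordinate_values_def)

end

section \<open>The construction over a fixed pair of sofic approximations with common tolerance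
  \<open>\<delta>\<close>\<close>

locale wreath_sofic = wreath_finite_subset G H F
  for G :: "('g, 'm) monoid_scheme" and H :: "('h, 'n) monoid_scheme"
    and F :: "(('h \<Rightarrow> 'g) \<times> 'h) set" +
  fixes A :: "'a set" and B :: "'b set" and \<sigma>A \<sigma>B and \<delta> :: real
  assumes finite_A: "finite A" and A_nonempty: "A \<noteq> {}"
    and finite_B: "finite B" and B_nonempty: "B \<noteq> {}"
    and sofic_A: "sofic_approximation G (coordinate_values G H F) \<delta> A \<sigma>A"
    and sofic_B: "sofic_approximation H (quotients H (E_set G H F)) \<delta> B \<sigma>B"
    and \<delta>_pos: "\<delta> > 0"
begin

abbreviation "P \<equiv> B \<rightarrow>\<^sub>E A"
abbreviation "B0 \<equiv> B0_set H E B \<sigma>B"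
abbreviation "fibre \<equiv> fibre_perm E A B \<sigma>A \<sigma>B"
abbreviation "hat \<equiv> hat_sigma G H F A B \<sigma>A \<sigma>B"

lemmas sofic_A' = sofic_A[unfolded sofic_approximation_iff[OF finite_A A_nonempty]]
lemmas sofic_B' = sofic_B[unfolded sofic_approximation_iff[OF finite_B B_nonempty]]

lemma \<sigma>A_permutes: "g \<in> carrier G \<Longrightarrow> \<sigma>A g permutes A"
  and \<sigma>A_one: "\<sigma>A \<one>\<^bsub>G\<^esub> = id"
  and \<sigma>B_permutes: "h \<in> carrier H \<Longrightarrow> \<sigma>B h permutes B"
  and \<sigma>B_one: "\<sigma>B \<one>\<^bsub>H\<^esub> = id"
  using sofic_A' sofic_B' by blast+

lemma \<sigma>A_mult_defect_less:
  assumes "g \<in> coordinate_values G H F" "g' \<in> coordinate_values G H F"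
  shows "real (card {\<alpha> \<in> A. \<sigma>A g' (\<sigma>A g \<alpha>) \<noteq> \<sigma>A (g \<otimes>\<^bsub>G\<^esub> g') \<alpha>}) < \<delta> * real (card A)"
  using sofic_A' assms by blast

lemma \<sigma>A_fixed_points_less:
  assumes "g \<in> coordinate_values G H F" "g \<noteq> \<one>\<^bsub>G\<^esub>"
  shows "real (card {\<alpha> \<in> A. \<sigma>A g \<alpha> = \<alpha>}) < \<delta> * real (card A)"
  using sofic_A' assms by blast

lemma \<sigma>B_fixed_points_less:
  assumes "h \<in> quotients H E" "h \<noteq> \<one>\<^bsub>H\<^esub>"
  shows "real (card {b \<in> B. \<sigma>B h b = b}) < \<delta> * real (card B)"
  using sofic_B' assms by blast

lemma B0_subset: "B0 \<subseteq> B"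
  by (auto simp: B0_set_def B01_set_def)

lemma B0_inj: "b \<in> B0 \<Longrightarrow> inj_on (\<lambda>x. \<sigma>B x b) E"
  by (auto simp: B0_set_def B01_set_def inj_on_def)

lemma B0_mult: "b \<in> B0 \<Longrightarrow> x \<in> E \<Longrightarrow> y \<in> E \<Longrightarrow> \<sigma>B y (\<sigma>B x b) = \<sigma>B (x \<otimes>\<^bsub>H\<^esub> y) b"
  by (simp add: B0_set_def B02_set_def Sym_group_def)

lemma fibre_eq_coordwise:
  assumes "b \<in> B0" "g \<in> carrier (base_group G H)"
  shows "fibre b g = coordwise A B
    (\<lambda>c. if c \<in> (\<lambda>x. \<sigma>B x b) ` E then \<sigma>A (g (inv_into E (\<lambda>x. \<sigma>B x b) c)) else id)"
  using assms E_subset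
  by (intro fibre_perm_eq_coordwise finite_E B0_inj \<sigma>A_permutes base_group_closed) auto

lemma fibre_permutes:
  assumes "b \<in> B0" "g \<in> carrier (base_group G H)"
  shows "fibre b g permutes P"
  unfolding fibre_eq_coordwise[OF assms]
proof (rule coordwise_permutes)
  fix c
  show "(if c \<in> (\<lambda>x. \<sigma>B x b) ` E then \<sigma>A (g (inv_into E (\<lambda>x. \<sigma>B x b) c)) else id) permutes A"
    using assms(2) E_subset inv_into_into[of c "\<lambda>x. \<sigma>B x b" E]
    by (simp add: permutes_id) (blast intro: \<sigma>A_permutes base_group_closed)
qed

lemma fibre_in_P: "b \<in> B0 \<Longrightarrow> g \<in> carrier (base_group G H) \<Longrightarrow> a \<in> P \<Longrightarrow> fibre b g a \<in> P"
  by (simp add: permutes_in_image[OF fibre_permutes])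

lemma fibre_apply_in:
  assumes "b \<in> B0" "g \<in> carrier (base_group G H)" "a \<in> P" "x \<in> E"
  shows "fibre b g a (\<sigma>B x b) = \<sigma>A (g x) (a (\<sigma>B x b))"
proof -
  have "\<sigma>B x b \<in> B"
    using assms E_subset B0_subset by (subst permutes_in_image[OF \<sigma>B_permutes]) auto
  then show ?thesis
    using assms inv_into_f_f[OF B0_inj, of b x]
    by (simp add: fibre_eq_coordwise coordwise_def)
qed

text \<open>Indices in \<open>E\<close> off the support act by \<open>\<sigma>A 1 = id\<close>, so
  only coordinates coming from the support have to be avoided.\<close>

lemma fibre_apply_not_in:
  assumes "b \<in> B0" "g \<in> carrier (base_group G H)" "a \<in> P" "c \<in> B"
    and "\<And>x. x \<in> Supp G H g \<Longrightarrow> x \<in> E \<Longrightarrow> c \<noteq> \<sigma>B x b"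
  shows "fibre b g a c = a c"
proof (cases "c \<in> (\<lambda>x. \<sigma>B x b) ` E")
  case True
  then obtain x where x: "x \<in> E" "c = \<sigma>B x b"
    by auto
  then have "g x = \<one>\<^bsub>G\<^esub>"
    using assms(5)[of x] E_subset by (auto simp: Supp_def)
  then show ?thesis
    using x assms by (simp add: fibre_apply_in \<sigma>A_one)
next
  case False
  then show ?thesis
    using assms by (simp add: fibre_eq_coordwise coordwise_def)
qed

lemma hat_A_permutes:
  assumes "g \<in> carrier (base_group G H)"
  shows "hat_A G H E A B \<sigma>A \<sigma>B g permutes P \<times> B"
proof -
  have "(\<lambda>(a, b). if b \<in> B0 then (fibre b g a, b) else (a, b)) permutes P \<times> B"
    using assms by (intro permutes_fibrewise fibre_permutes B0_subset)
  then show ?thesis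
    by (simp add: hat_A_def permutes_id)
qed

lemma hat_permutes:
  assumes "w \<in> carrier (wreath G H)"
  shows "hat w permutes P \<times> B"
proof -
  obtain g h where gh: "w = (g, h)" "g \<in> carrier (base_group G H)" "h \<in> carrier H"
    using assms by (auto simp: wreath_def)
  show ?thesis
    using permutes_compose[OF hat_A_permutes[OF gh(2)]
        hat_B_permutes[where \<sigma>B = \<sigma>B and h = h, OF \<sigma>B_permutes[OF gh(3)]]]
    by (simp add: gh(1) hat_sigma_def Sym_group_def)
qed

lemma hat_apply:
  assumes "a \<in> P" "b \<in> B0" "g \<in> carrier (base_group G H)" "Supp G H g \<subseteq> E"
  shows "hat (g, h) (a, b) = (fibre b g a, \<sigma>B h b)"
  using assms fibre_in_P[OF assms(2,3,1)]
  by (simp add: hat_sigma_def Sym_group_def hat_A_def hat_B_def)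

text \<open>Valid over every base point, in \<open>B0\<close> or not, because \<open>hat_A\<close>
  never moves the second component.\<close>

lemma snd_hat:
  assumes "a \<in> P" "g \<in> carrier (base_group G H)"
  shows "snd (hat (g, h) (a, b)) = \<sigma>B h b"
  using assms fibre_in_P[of b g a]
  by (simp add: hat_sigma_def Sym_group_def hat_A_def hat_B_def)

lemma hat_one: "hat \<one>\<^bsub>wreath G H\<^esub> = id"
proof
  fix p :: "('b \<Rightarrow> 'a) \<times> 'b"
  let ?e = "\<lambda>x\<in>carrier H. \<one>\<^bsub>G\<^esub>"
  obtain a b where p: "p = (a, b)"
    by force
  have e: "?e \<in> carrier (base_group G H)"
    by (auto simp: carrier_sum_group G.is_group)
  have "fibre b ?e a = a" if b: "b \<in> B0"
  proof (cases "a \<in> P")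
    case True
    show ?thesis
    proof (rule extensionalityI)
      show "fibre b ?e a \<in> extensional B" "a \<in> extensional B"
        using fibre_in_P[OF b e True] True by (auto simp: PiE_def)
    qed (rule fibre_apply_not_in[OF b e True], auto simp: Supp_def)
  next
    case False
    then show ?thesis
      by (rule permutes_not_in[OF fibre_permutes[OF b e]])
  qed
  then show "hat \<one>\<^bsub>wreath G H\<^esub> p = id p"
    unfolding p by (simp add: wreath_def hat_sigma_def Sym_group_def hat_A_def hat_B_def \<sigma>B_one)
qed

text \<open>Compared coordinate by coordinate. At \<open>\<sigma>B x b\<close> with \<open>x\<close>
  in \<open>E\<close>, first \<open>g\<close> contributes \<open>\<sigma>A (g x)\<close>, then
  \<open>g'\<close> over \<open>\<sigma>B h b\<close> contributes the value at
  \<open>inv h * x\<close>; \<open>mult\<close> merges the two. On all other coordinates both sides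
  are trivial.\<close>

lemma fibre_mult:
  assumes w: "(g, h) \<in> F" and w': "(g', h') \<in> F" and a: "a \<in> P"
    and b: "b \<in> B0" and hb: "\<sigma>B h b \<in> B0"
    and mult: "\<And>x. x \<in> E \<Longrightarrow> \<sigma>A (g' (inv\<^bsub>H\<^esub> h \<otimes>\<^bsub>H\<^esub> x)) (\<sigma>A (g x) (a (\<sigma>B x b))) =
      \<sigma>A (g x \<otimes>\<^bsub>G\<^esub> g' (inv\<^bsub>H\<^esub> h \<otimes>\<^bsub>H\<^esub> x)) (a (\<sigma>B x b))"
    and k: "k = (\<lambda>x\<in>carrier H. g x \<otimes>\<^bsub>G\<^esub> shift H h g' x)" "k \<in> carrier (base_group G H)"
    and Supp_k: "Supp G H k \<subseteq> E"
  shows "fibre (\<sigma>B h b) g' (fibre b g a) = fibre b k a"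
proof (rule extensionalityI)
  note g = F_memD(1)[OF w] and h = F_memD(2)[OF w] and g' = F_memD(1)[OF w']
  let ?a = "fibre b g a"
  have a': "?a \<in> P"
    by (rule fibre_in_P[OF b g a])
  show "fibre (\<sigma>B h b) g' ?a \<in> extensional B" "fibre b k a \<in> extensional B"
    using fibre_in_P[OF hb g' a'] fibre_in_P[OF b k(2) a] by (auto simp: PiE_def)
  fix c assume c: "c \<in> B"
  \<comment> \<open>The defining property of \<open>B02_set\<close>, with \<open>h\<close> and
    \<open>y\<close> both in \<open>E\<close>: coordinates seen from \<open>\<sigma>B h b\<close>
    are rewritten as coordinates seen from \<open>b\<close>.\<close>
  have move: "\<sigma>B y (\<sigma>B h b) = \<sigma>B (h \<otimes>\<^bsub>H\<^esub> y) b" if "y \<in> Supp G H g'" for y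
    using that b snd_in_E[OF w] Supp_subset_E[OF w'] by (intro B0_mult) auto
  show "fibre (\<sigma>B h b) g' ?a c = fibre b k a c"
  proof (cases "c \<in> (\<lambda>x. \<sigma>B x b) ` E")
    case True
    then obtain x where x: "x \<in> E" "c = \<sigma>B x b"
      by auto
    then have xH: "x \<in> carrier H"
      using E_subset by auto
    let ?y = "inv\<^bsub>H\<^esub> h \<otimes>\<^bsub>H\<^esub> x"
    have "fibre (\<sigma>B h b) g' ?a c = \<sigma>A (g' ?y) (?a c)"
    proof (cases "?y \<in> Supp G H g'")
      case True
      have "h \<otimes>\<^bsub>H\<^esub> ?y = x"
        using h xH by (simp add: H.m_assoc[symmetric])
      then have "c = \<sigma>B ?y (\<sigma>B h b)"
        using x move[OF True] by simp
      then show ?thesis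
        using True Supp_subset_E[OF w'] by (auto intro: fibre_apply_in[OF hb g' a'])
    next
      case False
      \<comment> \<open>Since \<open>h * z\<close> lies in \<open>E\<close>, injectivity over
        \<open>b\<close> turns equal coordinates into equal indices, so \<open>z\<close> would have
        to be \<open>inv h * x\<close>.\<close>
      have "c \<noteq> \<sigma>B z (\<sigma>B h b)" if z: "z \<in> Supp G H g'" for z
      proof
        assume "c = \<sigma>B z (\<sigma>B h b)"
        then have "\<sigma>B x b = \<sigma>B (h \<otimes>\<^bsub>H\<^esub> z) b"
          using x move[OF z] by simp
        then have "x = h \<otimes>\<^bsub>H\<^esub> z"
          using x(1) mult_Supp_in_E[OF w w' z] inj_onD[OF B0_inj[OF b]] by auto
        then have "?y = z"
          using h z by (simp add: Supp_def H.m_assoc[symmetric])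
        then show False
          using z False by simp
      qed
      then have "fibre (\<sigma>B h b) g' ?a c = ?a c"
        by (intro fibre_apply_not_in[OF hb g' a' c])
      moreover have "g' ?y = \<one>\<^bsub>G\<^esub>"
        using False h xH by (simp add: Supp_def)
      ultimately show ?thesis
        by (simp add: \<sigma>A_one)
    qed
    also have "\<dots> = \<sigma>A (g x \<otimes>\<^bsub>G\<^esub> g' ?y) (a c)"
      using mult[OF x(1)] fibre_apply_in[OF b g a x(1)] x(2) by simp
    also have "\<dots> = fibre b k a c"
      using fibre_apply_in[OF b k(2) a x(1)] x(2) xH by (simp add: k(1) shift_def)
    finally show ?thesis .
  next
    case False
    then have "c \<noteq> \<sigma>B y (\<sigma>B h b)" if "y \<in> Supp G H g'" for y
      using move[OF that] mult_Supp_in_E[OF w w' that] by auto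
    then have "fibre (\<sigma>B h b) g' ?a c = ?a c"
      by (intro fibre_apply_not_in[OF hb g' a' c])
    also have "\<dots> = a c"
      using False by (intro fibre_apply_not_in[OF b g a c]) auto
    also have "\<dots> = fibre b k a c"
      using False by (intro fibre_apply_not_in[OF b k(2) a c, symmetric]) auto
    finally show ?thesis .
  qed
qed

text \<open>The first components are handled by \<open>fibre_mult\<close>, the base points by
  \<open>B0_mult\<close> for \<open>h\<close> and \<open>h'\<close> in \<open>E\<close>.\<close>

lemma hat_mult:
  assumes w: "(g, h) \<in> F" and w': "(g', h') \<in> F" and a: "a \<in> P"
    and b: "b \<in> B0" and hb: "\<sigma>B h b \<in> B0"
    and mult: "\<And>x. x \<in> E \<Longrightarrow> \<sigma>A (g' (inv\<^bsub>H\<^esub> h \<otimes>\<^bsub>H\<^esub> x)) (\<sigma>A (g x) (a (\<sigma>B x b))) =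
      \<sigma>A (g x \<otimes>\<^bsub>G\<^esub> g' (inv\<^bsub>H\<^esub> h \<otimes>\<^bsub>H\<^esub> x)) (a (\<sigma>B x b))"
  shows "hat (g', h') (hat (g, h) (a, b)) = hat ((g, h) \<otimes>\<^bsub>wreath G H\<^esub> (g', h')) (a, b)"
proof -
  define k where "k = (\<lambda>x\<in>carrier H. g x \<otimes>\<^bsub>G\<^esub> shift H h g' x)"
  note g = F_memD(1)[OF w] and h = F_memD(2)[OF w] and g' = F_memD(1)[OF w']
  interpret W: group "wreath G H"
    by (intro group_wreath G.is_group H.is_group)
  have prod: "(g, h) \<otimes>\<^bsub>wreath G H\<^esub> (g', h') = (k, h \<otimes>\<^bsub>H\<^esub> h')"
    by (simp add: wreath_def k_def)
  have "(k, h \<otimes>\<^bsub>H\<^esub> h') \<in> carrier (wreath G H)"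
    using w w' F_subset unfolding prod[symmetric] by (intro W.m_closed) auto
  then have k: "k \<in> carrier (base_group G H)"
    by (simp add: wreath_def)
  \<comment> \<open>Otherwise \<open>hat_A\<close> would send \<open>k\<close> to its default value,
    the identity.\<close>
  have Supp_k: "Supp G H k \<subseteq> E"
  proof
    fix x assume x: "x \<in> Supp G H k"
    then have xH: "x \<in> carrier H"
      by (simp add: Supp_def)
    have "x \<in> Supp G H g \<or> inv\<^bsub>H\<^esub> h \<otimes>\<^bsub>H\<^esub> x \<in> Supp G H g'"
      using x h by (auto simp: Supp_def k_def shift_def)
    moreover have "h \<otimes>\<^bsub>H\<^esub> (inv\<^bsub>H\<^esub> h \<otimes>\<^bsub>H\<^esub> x) = x"
      using h xH by (simp add: H.m_assoc[symmetric])
    ultimately show "x \<in> E"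
      using Supp_subset_E[OF w] mult_Supp_in_E[OF w w', of "inv\<^bsub>H\<^esub> h \<otimes>\<^bsub>H\<^esub> x"] by auto
  qed
  have "hat (g', h') (hat (g, h) (a, b)) = (fibre (\<sigma>B h b) g' (fibre b g a), \<sigma>B h' (\<sigma>B h b))"
    using a b hb g g' Supp_subset_E[OF w] Supp_subset_E[OF w'] by (simp add: hat_apply fibre_in_P)
  also have "\<dots> = (fibre b k a, \<sigma>B (h \<otimes>\<^bsub>H\<^esub> h') b)"
    using fibre_mult[OF assms k_def k Supp_k] B0_mult[OF b snd_in_E[OF w] snd_in_E[OF w']] by simp
  also have "\<dots> = hat (k, h \<otimes>\<^bsub>H\<^esub> h') (a, b)"
    using a b k Supp_k by (simp add: hat_apply)
  finally show ?thesis
    by (simp add: prod)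
qed

section \<open>Density estimates on the space of pairs\<close>

lemma finite_P: "finite P"
  by (intro finite_PiE finite_B finite_A)

lemma card_space_pos: "card (P \<times> B) > 0"
  using finite_P finite_B A_nonempty B_nonempty by (simp add: card_gt_0_iff PiE_eq_empty_iff)

lemma card_E_ge_1: "real (card E) \<ge> 1"
  using finite_E E_nonempty by (simp add: Suc_le_eq card_gt_0_iff)

lemma card_B_minus_B0_le: "real (card (B - B0)) \<le> 4 * real (card E) ^ 2 * \<delta> * real (card B)"
  using \<delta>_pos by (intro card_complement_B0_le H.is_group finite_B B_nonempty finite_E E_subset sofic_B) auto

lemma coordinate_mult_defect_le:
  assumes w: "(g, h) \<in> F" and w': "(g', h') \<in> F" and x: "x \<in> E" and b: "b \<in> B0"
  defines "y \<equiv> inv\<^bsub>H\<^esub> h \<otimes>\<^bsub>H\<^esub> x"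
  shows "real (card {a \<in> P. \<sigma>A (g' y) (\<sigma>A (g x) (a (\<sigma>B x b))) \<noteq> \<sigma>A (g x \<otimes>\<^bsub>G\<^esub> g' y) (a (\<sigma>B x b))})
    \<le> \<delta> * real (card P)"
proof (rule card_PiE_coordinate_le[OF finite_A A_nonempty finite_B])
  have "x \<in> carrier H" "y \<in> carrier H"
    using x E_subset F_memD(2)[OF w] by (auto simp: y_def)
  then have "g x \<in> coordinate_values G H F" "g' y \<in> coordinate_values G H F"
    using coordinate_values_memI w w' by blast+
  then show "real (card {\<alpha> \<in> A. \<sigma>A (g' y) (\<sigma>A (g x) \<alpha>) \<noteq> \<sigma>A (g x \<otimes>\<^bsub>G\<^esub> g' y) \<alpha>}) \<le> \<delta> * real (card A)"
    by (intro less_imp_le \<sigma>A_mult_defect_less)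
  show "\<sigma>B x b \<in> B"
    using b B0_subset by (auto simp: permutes_in_image[OF \<sigma>B_permutes[OF \<open>x \<in> carrier H\<close>]])
qed

text \<open>Over a good base point, a failure at \<open>a\<close> forces a defect of
  \<open>\<sigma>A\<close> at one of the \<open>card E\<close> coordinates; base points that are not
  good are discarded.\<close>

lemma hat_mult_defect_le:
  assumes w: "(g, h) \<in> F" and w': "(g', h') \<in> F"
  shows "real (card {p \<in> P \<times> B. hat (g', h') (hat (g, h) p) \<noteq> hat ((g, h) \<otimes>\<^bsub>wreath G H\<^esub> (g', h')) p})
    \<le> (real (card E) * \<delta> + 8 * real (card E) ^ 2 * \<delta>) * real (card (P \<times> B))"
proof (rule card_fibrewise_le[OF finite_P finite_B])
  let ?D = "{p \<in> P \<times> B. hat (g', h') (hat (g, h) p) \<noteq> hat ((g, h) \<otimes>\<^bsub>wreath G H\<^esub> (g', h')) p}"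
  \<comment> \<open>Both \<open>b\<close> and \<open>\<sigma>B h b\<close> must lie in
    \<open>B0\<close>. As \<open>\<sigma>B h\<close> is injective, this doubles the bound on the
    complement, whence the factor 8.\<close>
  let ?B' = "(B - B0) \<union> {b \<in> B. \<sigma>B h b \<in> B - B0}"
  have h: "\<sigma>B h permutes B"
    using F_memD(2)[OF w] by (rule \<sigma>B_permutes)
  show "?D \<subseteq> P \<times> B" "?B' \<subseteq> B" "real (card E) * \<delta> \<ge> 0"
    using \<delta>_pos by auto
  have "card {b \<in> B. \<sigma>B h b \<in> B - B0} \<le> card (B - B0)"
    using finite_B by (intro card_inj_on_le[of "\<sigma>B h"] inj_on_subset[OF permutes_inj[OF h]]) auto
  then have "real (card ?B') \<le> 2 * real (card (B - B0))"
    using card_Un_le[of "B - B0" "{b \<in> B. \<sigma>B h b \<in> B - B0}"] by linarith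
  then show "real (card ?B') \<le> 8 * real (card E) ^ 2 * \<delta> * real (card B)"
    using card_B_minus_B0_le by linarith
  fix b assume "b \<in> B - ?B'"
  then have b: "b \<in> B" "b \<in> B0" "\<sigma>B h b \<in> B0"
    using permutes_in_image[OF h] by auto
  let ?bad = "\<lambda>x. {a \<in> P. \<sigma>A (g' (inv\<^bsub>H\<^esub> h \<otimes>\<^bsub>H\<^esub> x)) (\<sigma>A (g x) (a (\<sigma>B x b)))
    \<noteq> \<sigma>A (g x \<otimes>\<^bsub>G\<^esub> g' (inv\<^bsub>H\<^esub> h \<otimes>\<^bsub>H\<^esub> x)) (a (\<sigma>B x b))}"
  have "{a \<in> P. (a, b) \<in> ?D} \<subseteq> (\<Union>x\<in>E. ?bad x)"
    using hat_mult[OF w w' _ b(2,3)] by blast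
  then have "real (card {a \<in> P. (a, b) \<in> ?D}) \<le> real (card (\<Union>x\<in>E. ?bad x))"
    using finite_P finite_E by (intro of_nat_mono card_mono) auto
  also have "\<dots> \<le> real (card E) * (\<delta> * real (card P))"
    using coordinate_mult_defect_le[OF w w' _ b(2)] by (intro card_UN_le_mult finite_E)
  finally show "real (card {a \<in> P. (a, b) \<in> ?D}) \<le> real (card E) * \<delta> * real (card P)"
    by (simp only: mult.assoc)
qed

text \<open>If \<open>h\<close> is not \<open>1\<close>, a fixed pair has its base point fixed by
  \<open>\<sigma>B h\<close>. If \<open>h = 1\<close>, some \<open>g x\<close> is not
  \<open>1\<close>, and over \<open>B0\<close> a fixed pair has its coordinate at
  \<open>\<sigma>B x b\<close> fixed by \<open>\<sigma>A (g x)\<close>.\<close>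

lemma hat_fixed_points_le:
  assumes w: "(g, h) \<in> F" and "(g, h) \<noteq> \<one>\<^bsub>wreath G H\<^esub>"
  shows "real (card {p \<in> P \<times> B. hat (g, h) p = p})
    \<le> (\<delta> + 4 * real (card E) ^ 2 * \<delta>) * real (card (P \<times> B))"
proof (cases "h = \<one>\<^bsub>H\<^esub>")
  case False
  have "real (card {p \<in> P \<times> B. hat (g, h) p = p}) \<le> (0 + \<delta>) * real (card (P \<times> B))"
  proof (rule card_fibrewise_le[OF finite_P finite_B])
    have "h \<in> quotients H E"
      using snd_in_E[OF w] by (simp add: quotients_def)
    then show "real (card {b \<in> B. \<sigma>B h b = b}) \<le> \<delta> * real (card B)"
      using False by (intro less_imp_le \<sigma>B_fixed_points_less)
    fix b assume "b \<in> B - {b \<in> B. \<sigma>B h b = b}"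
    \<comment> \<open>Over a base point moved by \<open>\<sigma>B h\<close> there are no fixed pairs
      at all, so the fibre bound is 0.\<close>
    then have "{a \<in> P. (a, b) \<in> {p \<in> P \<times> B. hat (g, h) p = p}} = {}"
      using snd_hat[of _ g h b] F_memD(1)[OF w] by force
    then show "real (card {a \<in> P. (a, b) \<in> {p \<in> P \<times> B. hat (g, h) p = p}}) \<le> 0 * real (card P)"
      by (simp only: card.empty of_nat_0 mult_zero_left order_refl)
  qed auto
  also have "\<dots> \<le> (\<delta> + 4 * real (card E) ^ 2 * \<delta>) * real (card (P \<times> B))"
    using \<delta>_pos by (intro mult_right_mono) auto
  finally show ?thesis .
next
  case True
  note g = F_memD(1)[OF w]
  have "g \<noteq> (\<lambda>x\<in>carrier H. \<one>\<^bsub>G\<^esub>)"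
    using assms(2) True by (auto simp: wreath_def)
  then obtain x where x: "x \<in> carrier H" "g x \<noteq> \<one>\<^bsub>G\<^esub>"
    using extensionalityI[OF base_group_extensional[OF g], of "\<lambda>x\<in>carrier H. \<one>\<^bsub>G\<^esub>"] by auto
  then have xE: "x \<in> E"
    using Supp_subset_E[OF w] by (auto simp: Supp_def)
  show ?thesis
  proof (rule card_fibrewise_le[OF finite_P finite_B _ _ _ card_B_minus_B0_le])
    fix b assume "b \<in> B - (B - B0)"
    then have b: "b \<in> B" "b \<in> B0"
      by auto
    have "{a \<in> P. (a, b) \<in> {p \<in> P \<times> B. hat (g, h) p = p}}
        \<subseteq> {a \<in> P. \<sigma>A (g x) (a (\<sigma>B x b)) = a (\<sigma>B x b)}"
    proof
      fix a assume "a \<in> {a \<in> P. (a, b) \<in> {p \<in> P \<times> B. hat (g, h) p = p}}"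
      then have a: "a \<in> P" "fibre b g a = a"
        using hat_apply[OF _ b(2) g Supp_subset_E[OF w]] by auto
      then show "a \<in> {a \<in> P. \<sigma>A (g x) (a (\<sigma>B x b)) = a (\<sigma>B x b)}"
        using fibre_apply_in[OF b(2) g a(1) xE, symmetric]
        by (intro CollectI conjI) (simp_all only: a)
    qed
    then have "real (card {a \<in> P. (a, b) \<in> {p \<in> P \<times> B. hat (g, h) p = p}})
        \<le> real (card {a \<in> P. \<sigma>A (g x) (a (\<sigma>B x b)) = a (\<sigma>B x b)})"
      using finite_P by (intro of_nat_mono card_mono) auto
    also have "\<dots> \<le> \<delta> * real (card P)"
    proof (rule card_PiE_coordinate_le[OF finite_A A_nonempty finite_B])
      show "\<sigma>B x b \<in> B"
        using b by (simp add: permutes_in_image[OF \<sigma>B_permutes[OF x(1)]])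
      show "real (card {\<alpha> \<in> A. \<sigma>A (g x) \<alpha> = \<alpha>}) \<le> \<delta> * real (card A)"
        using x by (intro less_imp_le \<sigma>A_fixed_points_less coordinate_values_memI[OF w])
    qed
    finally show "real (card {a \<in> P. (a, b) \<in> {p \<in> P \<times> B. hat (g, h) p = p}}) \<le> \<delta> * real (card P)" .
  qed (use \<delta>_pos in auto)
qed

text \<open>Since \<open>card E\<close> is at least 1, the multiplicativity bound is at most
  \<open>(1 + 8) * card E ^ 2 * \<delta>\<close> and the freeness bound at most
  \<open>(1 + 4) * card E ^ 2 * \<delta>\<close>.\<close>

lemma sofic_approximation_hat:
  assumes "9 * real (card E) ^ 2 * \<delta> < \<epsilon>"
  shows "sofic_approximation (wreath G H) F \<epsilon> (P \<times> B) hat"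
proof -
  have "real (card E) \<le> real (card E) ^ 2" "1 \<le> real (card E) ^ 2"
    using card_E_ge_1 by (simp_all add: self_le_power one_le_power)
  then have "real (card E) * \<delta> \<le> real (card E) ^ 2 * \<delta>" "1 * \<delta> \<le> real (card E) ^ 2 * \<delta>"
    using \<delta>_pos by (intro mult_right_mono; simp)+
  then have "real (card E) * \<delta> + 8 * real (card E) ^ 2 * \<delta> < \<epsilon>"
    "\<delta> + 4 * real (card E) ^ 2 * \<delta> < \<epsilon>"
    using assms \<delta>_pos by linarith+
  then have less: "(real (card E) * \<delta> + 8 * real (card E) ^ 2 * \<delta>) * real (card (P \<times> B))
      < \<epsilon> * real (card (P \<times> B))"
    "(\<delta> + 4 * real (card E) ^ 2 * \<delta>) * real (card (P \<times> B)) < \<epsilon> * real (card (P \<times> B))"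
    using card_space_pos by (intro mult_strict_right_mono; simp)+
  have ne: "finite (P \<times> B)" "P \<times> B \<noteq> {}"
    using finite_P finite_B card_space_pos by (simp, metis card.empty less_irrefl)
  show ?thesis
    unfolding sofic_approximation_iff[OF ne]
  proof (intro conjI ballI)
    fix w w' assume "w \<in> F" "w' \<in> F"
    then show "real (card {p \<in> P \<times> B. hat w' (hat w p) \<noteq> hat (w \<otimes>\<^bsub>wreath G H\<^esub> w') p})
        < \<epsilon> * real (card (P \<times> B))"
      by (cases w, cases w') (simp only: le_less_trans[OF hat_mult_defect_le less(1)])
  next
    fix w assume "w \<in> F - {\<one>\<^bsub>wreath G H\<^esub>}"
    moreover obtain g h where "w = (g, h)"
      by (cases w)
    ultimately have w: "w = (g, h)" "(g, h) \<in> F" "(g, h) \<noteq> \<one>\<^bsub>wreath G H\<^esub>"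
      by auto
    show "real (card {p \<in> P \<times> B. hat w p = p}) < \<epsilon> * real (card (P \<times> B))"
      unfolding w(1) by (rule le_less_trans[OF hat_fixed_points_le[OF w(2,3)] less(2)])
  qed (rule hat_permutes hat_one, assumption?)+
qed

end

section \<open>The choice of test sets and tolerance\<close>

theorem proposition2p1:
  fixes G :: "('g, 'm) monoid_scheme" and H :: "('h, 'n) monoid_scheme"
    and F :: "(('h \<Rightarrow> 'g) \<times> 'h) set" and \<epsilon> :: real
  assumes "group G" and "countable (carrier G)"
    and "group H" and "countable (carrier H)"
    and "finite F" and "F \<subseteq> carrier (wreath G H)" and "\<epsilon> > 0"
  shows "\<exists>EA EB \<epsilon>'. finite EA \<and> EA \<subseteq> carrier G \<and> finite EB \<and> EB \<subseteq> carrier H \<and> (\<epsilon>' :: real) > 0 \<and>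
    (\<forall>(A :: 'a set) (B :: 'b set) \<sigma>A \<sigma>B.
       finite A \<and> A \<noteq> {} \<and> finite B \<and> B \<noteq> {} \<and>
       sofic_approximation G EA \<epsilon>' A \<sigma>A \<and> sofic_approximation H EB \<epsilon>' B \<sigma>B \<longrightarrow>
       sofic_approximation (wreath G H) F \<epsilon> ((B \<rightarrow>\<^sub>E A) \<times> B) (hat_sigma G H F A B \<sigma>A \<sigma>B))"
proof -
  interpret wreath_finite_subset G H F
    using assms by (intro wreath_finite_subset.intro wreath_finite_subset_axioms.intro)
  \<comment> \<open>The 10 makes \<open>9 * card E ^ 2 * \<delta>\<close> strictly smaller than
    \<open>\<epsilon>\<close>. Like the two test sets, \<open>\<delta>\<close> is fixed before
    \<open>A\<close> and \<open>B\<close> are given.\<close>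
  define \<delta> where "\<delta> = \<epsilon> / (10 * real (card E) ^ 2)"
  have E_pos: "real (card E) ^ 2 > 0"
    using finite_E E_nonempty by (simp add: card_gt_0_iff)
  then have \<delta>: "\<delta> > 0" "9 * real (card E) ^ 2 * \<delta> < \<epsilon>"
    using assms(7) by (simp_all add: \<delta>_def field_simps)
  show ?thesis
  proof (intro exI conjI allI impI)
    show "finite (coordinate_values G H F)" "coordinate_values G H F \<subseteq> carrier G"
      "finite (quotients H E)" "quotients H E \<subseteq> carrier H" "\<delta> > 0"
      using finite_coordinate_values coordinate_values_subset H.finite_quotients[OF finite_E]
        H.quotients_subset[OF E_subset] \<delta> by auto
    fix A :: "'a set" and B :: "'b set" and \<sigma>A \<sigma>B
    assume *: "finite A \<and> A \<noteq> {} \<and> finite B \<and> B \<noteq> {} \<and>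
      sofic_approximation G (coordinate_values G H F) \<delta> A \<sigma>A \<and>
      sofic_approximation H (quotients H E) \<delta> B \<sigma>B"
    interpret wreath_sofic G H F A B \<sigma>A \<sigma>B \<delta>
      using * \<delta>(1) by unfold_locales auto
    show "sofic_approximation (wreath G H) F \<epsilon> ((B \<rightarrow>\<^sub>E A) \<times> B) (hat_sigma G H F A B \<sigma>A \<sigma>B)"
      by (rule sofic_approximation_hat[OF \<delta>(2)])
  qed
qed

end
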